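(* Let $\boldsymbol{X}=(X_1,\dots,X_d)=\boldsymbol Y+\boldsymbol Z$ follow the multivariate comonotonic shock Poisson distribution with parameters $(\lambda_1,\dots,\lambda_d)\in(0,\infty)^d$ and $\theta\in[0,1]$, where $\boldsymbol Y=(Y_1,\dots,Y_d)$ and $\boldsymbol Z=(Z_1,\dots,Z_d)$. Then for every $x\in\mathbb N=\{0,1,2,\dots\}$, as $\theta\to1$ with $\lambda_1,\dots,\lambda_d$ fixed, $$F_{M^{\boldsymbol X}}(x)\sim F_{M^{\boldsymbol Z}}(x),\qquad F_{m^{\boldsymbol X}}(x)\sim F_{m^{\boldsymbol Z}}(x).$$
   Context: $\mathcal P(\lambda)$ denotes the Poisson distribution with rate $\lambda\ge0$ ($\mathcal P(0)$ is the point mass at $0$) and $G_\lambda$ its cumulative distribution function. A random vector $(X_1,\dots,X_d)$ follows the multivariate comonotonic shock Poisson distribution with parameters $(\lambda_1,\dots,\lambda_d)\in(0,\infty)^d$ and $\theta\in[0,1]$ if $(X_1,\dots,X_d)=(Y_1,\dots,Y_d)+(Z_1,\dots,Z_d)$, where the vectors $\boldsymbol Y=(Y_1,\dots,Y_d)$ and $\boldsymbol Z=(Z_1,\dots,Z_d)$ are independent of each other and: (i) $Y_1,\dots,Y_d$ are mutually independent with $Y_j\sim\mathcal P((1-\theta)\lambda_j)$; (ii) $Z_1,\dots,Z_d$ are comonotonic with $Z_j\sim\mathcal P(\theta\lambda_j)$, i.e. $(Z_1,\dots,Z_d)=(G_{\theta\lambda_1}^{-1}(U),\dots,G_{\theta\lambda_d}^{-1}(U))$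 for one random variable $U$ uniform on $(0,1)$, where $F^{-1}(u)=\inf\{t\in\mathbb R:F(t)\ge u\}$. (The laws of both $\boldsymbol Y$ and $\boldsymbol Z$ depend on $\theta$.) For a random vector $\boldsymbol\xi=(\xi_1,\dots,\xi_d)$: $M^{\boldsymbol\xi}=\max(\xi_1,\dots,\xi_d)$, $m^{\boldsymbol\xi}=\min(\xi_1,\dots,\xi_d)$. $F_W$ denotes the cumulative distribution function of a random variable $W$. The notation $f(x;\kappa)\sim g(x;\kappa)$ as $\kappa\to\kappa_0$ means $\lim_{\kappa\to\kappa_0}f(x;\kappa)/g(x;\kappa)=1$. *)

theory Defs
  imports "HOL-Probability.Probability"
begin

(* The case distinction is needed because poisson_pmf is only specified for a positive rate. *)
definition poisson_law :: "real \<Rightarrow> real measure" where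
  "poisson_law rate =
     distr (measure_pmf (if rate = 0 then return_pmf 0 else poisson_pmf rate)) borel real"

(* Meaningful for 0 < u < 1, where the set is nonempty and bounded below if F is a cdf. *)
definition quantile :: "(real \<Rightarrow> real) \<Rightarrow> real \<Rightarrow> real" where
  "quantile F u = Inf {t. F t \<ge> u}"

(* Random vectors are indexed by 1..d.  Identities between random variables are required almost
   surely; in particular the values of U outside (0,1), a null event, are irrelevant.
   No relation is imposed between the variable U and the vector Y beyond the independence of
   the vectors Y and Z. *)
locale comonotonic_shock_poisson = prob_space M
  for M :: "'a measure" +
  fixes d :: nat
    and lam :: "nat \<Rightarrow> real"
    and theta :: real
    and X Y Z :: "nat \<Rightarrow> 'a \<Rightarrow> real"
  assumes dim_pos: "d \<ge> 1"
    and rates_pos: "\<And>j. j \<in> {1..d} \<Longrightarrow> lam j > 0"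
    and theta_range: "theta \<in> {0..1}"
    and X_measurable: "\<And>j. j \<in> {1..d} \<Longrightarrow> X j \<in> borel_measurable M"
    and X_eq: "\<And>j. j \<in> {1..d} \<Longrightarrow> AE \<omega> in M. X j \<omega> = Y j \<omega> + Z j \<omega>"
    and Y_Z_indep:
      "indep_var (Pi\<^sub>M {1..d} (\<lambda>_. borel)) (\<lambda>\<omega>. \<lambda>j\<in>{1..d}. Y j \<omega>)
                 (Pi\<^sub>M {1..d} (\<lambda>_. borel)) (\<lambda>\<omega>. \<lambda>j\<in>{1..d}. Z j \<omega>)"
    and Y_indep: "indep_vars (\<lambda>_. borel) Y {1..d}"
    and Y_law: "\<And>j. j \<in> {1..d} \<Longrightarrow> distr M borel (Y j) = poisson_law ((1 - theta) * lam j)"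
    and Z_law: "\<And>j. j \<in> {1..d} \<Longrightarrow> distr M borel (Z j) = poisson_law (theta * lam j)"
    and Z_comonotonic:
      "\<exists>U \<in> borel_measurable M.
         distr M borel U = uniform_measure lborel {0<..<1} \<and>
         (\<forall>j\<in>{1..d}. AE \<omega> in M. Z j \<omega> = quantile (cdf (poisson_law (theta * lam j))) (U \<omega>))"

definition vec_max :: "nat \<Rightarrow> (nat \<Rightarrow> 'a \<Rightarrow> real) \<Rightarrow> 'a \<Rightarrow> real" where
  "vec_max d \<xi> \<omega> = Max ((\<lambda>j. \<xi> j \<omega>) ` {1..d})"

definition vec_min :: "nat \<Rightarrow> (nat \<Rightarrow> 'a \<Rightarrow> real) \<Rightarrow> 'a \<Rightarrow> real" where
  "vec_min d \<xi> \<omega> = Min ((\<lambda>j. \<xi> j \<omega>) ` {1..d})"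

definition rv_cdf :: "'a measure \<Rightarrow> ('a \<Rightarrow> real) \<Rightarrow> real \<Rightarrow> real" where
  "rv_cdf M W = cdf (distr M borel W)"

end

theory Submission
  imports Defs
begin

text \<open>The vectors \<open>X\<close> and \<open>Z\<close> agree unless some \<open>Y\<^sub>j\<close> is nonzero, an event of
  probability at most \<open>\<Sum>j. 1 - exp (-(1 - \<theta>) \<lambda>\<^sub>j) \<longlonglongrightarrow> 0\<close>, so the distribution
  functions of their extrema differ by a quantity tending to \<open>0\<close>. On the other hand, all \<open>Z\<^sub>j\<close>
  vanish as soon as the common uniform variable satisfies \<open>U \<le> exp (- \<Sum>j. \<lambda>\<^sub>j)\<close>, so both
  denominators are bounded away from \<open>0\<close> uniformly in \<open>\<theta>\<close>.\<close>

lemma measure_poisson_law_zero: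
  assumes "r \<ge> 0"
  shows "measure (poisson_law r) {0} = exp (- r)"
proof -
  have *: "real -` {0} = {0}"
    by auto
  show ?thesis
    using assms by (simp add: poisson_law_def measure_distr * measure_pmf_single)
qed

lemma cdf_poisson_law_zero:
  assumes "r \<ge> 0"
  shows "cdf (poisson_law r) 0 = exp (- r)"
proof -
  have *: "real -` {..0} = {0}"
    by auto
  show ?thesis
    using assms by (simp add: cdf_def poisson_law_def measure_distr * measure_pmf_single)
qed

lemma cdf_poisson_law_neg:
  assumes "t < 0"
  shows "cdf (poisson_law r) t = 0"
proof -
  have *: "real -` {..t} = {}"
    using assms by auto
  show ?thesis
    by (simp add: cdf_def poisson_law_def measure_distr *)
qed

text \<open>The point 0 lies in the set whose infimum is the quantile, because the cdf at 0 is the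
  atom \<open>exp (- r)\<close>. Strict positivity of \<open>u\<close> excludes all negative points,
  where the cdf vanishes, so the set is bounded below and \<open>Inf\<close> on the reals is
  meaningful.\<close>

lemma quantile_poisson_law_le_zero:
  assumes "r \<ge> 0" "0 < u" "u \<le> exp (- r)"
  shows "quantile (cdf (poisson_law r)) u \<le> 0"
  unfolding quantile_def
proof (rule cInf_lower)
  show "0 \<in> {t. cdf (poisson_law r) t \<ge> u}"
    using assms by (simp add: cdf_poisson_law_zero)
  show "bdd_below {t. cdf (poisson_law r) t \<ge> u}"
  proof (rule bdd_belowI)
    fix t assume "t \<in> {t. cdf (poisson_law r) t \<ge> u}"
    then show "0 \<le> t"
      using assms cdf_poisson_law_neg[of t r] by (cases "t < 0") auto
  qed
qed

lemma vec_max_measurable: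
  assumes "\<And>j. j \<in> {1..d} \<Longrightarrow> \<xi> j \<in> borel_measurable M"
  shows "vec_max d \<xi> \<in> borel_measurable M"
  unfolding vec_max_def[abs_def] using assms by (intro borel_measurable_Max) auto

lemma vec_min_measurable:
  assumes "\<And>j. j \<in> {1..d} \<Longrightarrow> \<xi> j \<in> borel_measurable M"
  shows "vec_min d \<xi> \<in> borel_measurable M"
  unfolding vec_min_def[abs_def] using assms by (intro borel_measurable_Min) auto

lemma vec_max_le_iff:
  assumes "d \<ge> 1"
  shows "vec_max d \<xi> \<omega> \<le> t \<longleftrightarrow> (\<forall>j\<in>{1..d}. \<xi> j \<omega> \<le> t)"
  using assms unfolding vec_max_def by (subst Max_le_iff) auto

lemma vec_min_le_vec_max:
  assumes "d \<ge> 1"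
  shows "vec_min d \<xi> \<omega> \<le> vec_max d \<xi> \<omega>"
  using assms unfolding vec_min_def vec_max_def
  by (intro order_trans[OF Min_le[of _ "\<xi> 1 \<omega>"] Max_ge]) auto

context prob_space
begin

lemma rv_cdf_eq_prob:
  assumes "W \<in> borel_measurable M"
  shows "rv_cdf M W t = prob {\<omega> \<in> space M. W \<omega> \<le> t}"
  using assms by (auto simp: rv_cdf_def cdf_def measure_distr intro!: arg_cong[where f = prob])

text \<open>Coupling inequality: off \<open>A\<close> and a null set, the events that
  \<open>W\<close> and \<open>V\<close> are at most \<open>t\<close> coincide, so their
  probabilities differ by no more than the mass of \<open>A\<close>.\<close>

lemma rv_cdf_diff_le:
  assumes W [measurable]: "W \<in> borel_measurable M" and V [measurable]: "V \<in> borel_measurable M"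
    and A [measurable]: "A \<in> events"
    and eq: "AE \<omega> in M. \<omega> \<notin> A \<longrightarrow> W \<omega> = V \<omega>"
  shows "\<bar>rv_cdf M W t - rv_cdf M V t\<bar> \<le> prob A"
proof -
  \<comment> \<open>The one-sided bound is stated for an arbitrary pair so that it can be used in
    both orders, which yields the absolute value.\<close>
  have *: "rv_cdf M W' t \<le> rv_cdf M V' t + prob A"
    if [measurable]: "W' \<in> borel_measurable M" "V' \<in> borel_measurable M"
      and "AE \<omega> in M. \<omega> \<notin> A \<longrightarrow> W' \<omega> = V' \<omega>" for W' V'
  proof -
    have "prob {\<omega> \<in> space M. W' \<omega> \<le> t} \<le> prob ({\<omega> \<in> space M. V' \<omega> \<le> t} \<union> A)"
      using that(3) by (intro finite_measure_mono_AE) auto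
    also have "\<dots> \<le> prob {\<omega> \<in> space M. V' \<omega> \<le> t} + prob A"
      by (intro measure_Un_le) auto
    finally show ?thesis
      by (simp add: rv_cdf_eq_prob)
  qed
  have "AE \<omega> in M. \<omega> \<notin> A \<longrightarrow> V \<omega> = W \<omega>"
    using eq by auto
  with *[OF W V eq] *[OF V W] show ?thesis
    by linarith
qed

end

context comonotonic_shock_poisson
begin

lemma Y_measurable:
  assumes "j \<in> {1..d}"
  shows "Y j \<in> borel_measurable M"
  using Y_indep assms unfolding indep_vars_def by auto

text \<open>Measurability of the coordinates is implicit in the independence of the two vectors: the
  whole vector is a random variable into the product space, and projections are measurable.\<close>

lemma Z_measurable:
  assumes "j \<in> {1..d}"
  shows "Z j \<in> borel_measurable M"
proof -
  have "(\<lambda>\<omega>. \<lambda>j\<in>{1..d}. Z j \<omega>) \<in> measurable M (Pi\<^sub>M {1..d} (\<lambda>_. borel))"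
    using indep_var_rv2[OF Y_Z_indep] .
  from measurable_compose[OF this measurable_component_singleton[OF assms]]
  show ?thesis
    using assms by simp
qed

lemma prob_Y_nonzero:
  assumes j: "j \<in> {1..d}"
  shows "prob {\<omega> \<in> space M. Y j \<omega> \<noteq> 0} = 1 - exp (- ((1 - theta) * lam j))"
proof -
  have [measurable]: "Y j \<in> borel_measurable M"
    using j by (rule Y_measurable)
  have "prob {\<omega> \<in> space M. Y j \<omega> = 0} = measure (distr M borel (Y j)) {0}"
    by (auto simp: measure_distr intro!: arg_cong[where f = prob])
  also have "\<dots> = exp (- ((1 - theta) * lam j))"
    \<comment> \<open>The formula for the atom at 0 also covers rate 0, so the endpoint
      \<open>theta = 1\<close> requires no separate case.\<close>
    using theta_range rates_pos[OF j] by (simp add: Y_law[OF j] measure_poisson_law_zero)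
  finally show ?thesis
    by (subst prob_neg) auto
qed

text \<open>Union bound over the coordinates; it makes the coupling error an explicit function of
  \<open>theta\<close>.\<close>

lemma prob_some_Y_nonzero:
  "prob {\<omega> \<in> space M. \<exists>j\<in>{1..d}. Y j \<omega> \<noteq> 0} \<le> (\<Sum>j=1..d. 1 - exp (- ((1 - theta) * lam j)))"
proof -
  have [measurable]: "Y j \<in> borel_measurable M" if "j \<in> {1..d}" for j
    using that by (rule Y_measurable)
  have "prob (\<Union>j\<in>{1..d}. {\<omega> \<in> space M. Y j \<omega> \<noteq> 0})
          \<le> (\<Sum>j=1..d. prob {\<omega> \<in> space M. Y j \<omega> \<noteq> 0})"
    by (intro finite_measure_subadditive_finite) auto
  also have "(\<Union>j\<in>{1..d}. {\<omega> \<in> space M. Y j \<omega> \<noteq> 0}) = {\<omega> \<in> space M. \<exists>j\<in>{1..d}. Y j \<omega> \<noteq> 0}"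
    by auto
  finally show ?thesis
    by (simp add: prob_Y_nonzero)
qed

lemma AE_X_eq_Z:
  "AE \<omega> in M. \<omega> \<notin> {\<omega> \<in> space M. \<exists>j\<in>{1..d}. Y j \<omega> \<noteq> 0} \<longrightarrow> (\<forall>j\<in>{1..d}. X j \<omega> = Z j \<omega>)"
proof -
  have "AE \<omega> in M. \<forall>j\<in>{1..d}. X j \<omega> = Y j \<omega> + Z j \<omega>"
    by (intro AE_finite_allI X_eq) auto
  then show ?thesis
    \<comment> \<open>The exceptional event is a subset of \<open>space M\<close>, so only for
      points of the space does lying outside it force every \<open>Y j\<close> to vanish.\<close>
    using AE_space by eventually_elim auto
qed

lemma rv_cdf_vec_max_diff_le:
  "\<bar>rv_cdf M (vec_max d X) t - rv_cdf M (vec_max d Z) t\<bar>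
     \<le> (\<Sum>j=1..d. 1 - exp (- ((1 - theta) * lam j)))"
proof (rule order_trans[OF rv_cdf_diff_le prob_some_Y_nonzero])
  show "{\<omega> \<in> space M. \<exists>j\<in>{1..d}. Y j \<omega> \<noteq> 0} \<in> events"
    using Y_measurable by measurable
  show "AE \<omega> in M. \<omega> \<notin> {\<omega> \<in> space M. \<exists>j\<in>{1..d}. Y j \<omega> \<noteq> 0}
          \<longrightarrow> vec_max d X \<omega> = vec_max d Z \<omega>"
    using AE_X_eq_Z by eventually_elim (auto simp: vec_max_def)
qed (auto intro: vec_max_measurable X_measurable Z_measurable)

lemma rv_cdf_vec_min_diff_le:
  "\<bar>rv_cdf M (vec_min d X) t - rv_cdf M (vec_min d Z) t\<bar>
     \<le> (\<Sum>j=1..d. 1 - exp (- ((1 - theta) * lam j)))"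
proof (rule order_trans[OF rv_cdf_diff_le prob_some_Y_nonzero])
  show "{\<omega> \<in> space M. \<exists>j\<in>{1..d}. Y j \<omega> \<noteq> 0} \<in> events"
    using Y_measurable by measurable
  show "AE \<omega> in M. \<omega> \<notin> {\<omega> \<in> space M. \<exists>j\<in>{1..d}. Y j \<omega> \<noteq> 0}
          \<longrightarrow> vec_min d X \<omega> = vec_min d Z \<omega>"
    using AE_X_eq_Z by eventually_elim (auto simp: vec_min_def)
qed (auto intro: vec_min_measurable X_measurable Z_measurable)

text \<open>The sum of all \<open>lam j\<close> dominates every rate \<open>theta * lam j\<close>,
  so one threshold for \<open>U\<close>, free of \<open>theta\<close>, makes all quantiles
  nonpositive at once.\<close>

lemma rv_cdf_vec_max_Z_ge:
  assumes "t \<ge> 0"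
  shows "exp (- (\<Sum>j=1..d. lam j)) \<le> rv_cdf M (vec_max d Z) t"
proof -
  define c where "c = exp (- (\<Sum>j=1..d. lam j))"
  have c: "0 < c" "c \<le> 1"
    using rates_pos by (auto simp: c_def intro!: sum_nonneg intro: less_imp_le)
  have [measurable]: "vec_max d Z \<in> borel_measurable M"
    by (intro vec_max_measurable Z_measurable)
  obtain U where U [measurable]: "U \<in> borel_measurable M"
    and U_law: "distr M borel U = uniform_measure lborel {0<..<1}"
    and Z_eq: "\<And>j. j \<in> {1..d} \<Longrightarrow>
      AE \<omega> in M. Z j \<omega> = quantile (cdf (poisson_law (theta * lam j))) (U \<omega>)"
    using Z_comonotonic by auto
  have rate: "theta * lam j \<le> (\<Sum>j=1..d. lam j)" "0 \<le> theta * lam j" if j: "j \<in> {1..d}" for j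
  proof -
    have "theta * lam j \<le> lam j"
      using theta_range rates_pos[OF j] by (simp add: mult_left_le_one_le)
    also have "\<dots> \<le> (\<Sum>j=1..d. lam j)"
      using j rates_pos by (intro member_le_sum) (auto intro: less_imp_le)
    finally show "theta * lam j \<le> (\<Sum>j=1..d. lam j)" .
    show "0 \<le> theta * lam j"
      using theta_range rates_pos[OF j] by simp
  qed
  have "AE \<omega> in M. \<forall>j\<in>{1..d}. Z j \<omega> = quantile (cdf (poisson_law (theta * lam j))) (U \<omega>)"
    by (intro AE_finite_allI Z_eq) auto
  \<comment> \<open>The lower endpoint matters too: the quantile bound is available only for
    positive arguments.\<close>
  then have imp: "AE \<omega> in M. U \<omega> \<in> {0<..<c} \<longrightarrow> vec_max d Z \<omega> \<le> t"
  proof eventually_elim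
    case (elim \<omega>)
    show ?case
    proof
      assume u: "U \<omega> \<in> {0<..<c}"
      have "Z j \<omega> \<le> 0" if j: "j \<in> {1..d}" for j
      proof -
        have "U \<omega> \<le> exp (- (theta * lam j))"
          using u rate(1)[OF j] unfolding c_def
          by (auto intro: order_trans[OF less_imp_le])
        then show ?thesis
          using elim j u rate(2)[OF j] by (auto intro!: quantile_poisson_law_le_zero)
      qed
      then show "vec_max d Z \<omega> \<le> t"
        using assms dim_pos by (force simp: vec_max_le_iff)
    qed
  qed
  \<comment> \<open>Since \<open>c \<le> 1\<close>, the interval lies inside the unit interval and
    its uniform probability is its length.\<close>
  have "c = measure (uniform_measure lborel {0<..<1}) {0<..<c}"
  proof -
    have "{0<..<1} \<inter> {0<..<c} = {0<..<c}"
      using c by auto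
    then show ?thesis
      using c by (subst measure_uniform_measure) auto
  qed
  also have "\<dots> = prob (U -` {0<..<c} \<inter> space M)"
    by (simp flip: U_law add: measure_distr)
  also have "\<dots> \<le> prob {\<omega> \<in> space M. vec_max d Z \<omega> \<le> t}"
    using imp by (intro finite_measure_mono_AE) auto
  finally show ?thesis
    by (simp add: rv_cdf_eq_prob c_def)
qed

text \<open>The minimum is at most the maximum, so its distribution function is at least as large
  and inherits the lower bound.\<close>

lemma rv_cdf_vec_min_Z_ge:
  assumes "t \<ge> 0"
  shows "exp (- (\<Sum>j=1..d. lam j)) \<le> rv_cdf M (vec_min d Z) t"
proof -
  have [measurable]: "vec_max d Z \<in> borel_measurable M" "vec_min d Z \<in> borel_measurable M"
    by (intro vec_max_measurable vec_min_measurable Z_measurable; assumption)+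
  have "rv_cdf M (vec_max d Z) t \<le> rv_cdf M (vec_min d Z) t"
    using vec_min_le_vec_max[OF dim_pos, of Z]
    by (auto simp: rv_cdf_eq_prob intro!: finite_measure_mono intro: order_trans)
  with rv_cdf_vec_max_Z_ge[OF assms] show ?thesis
    by simp
qed

end

text \<open>A vanishing difference gives ratio 1 once the denominator stays above a fixed
  \<open>c > 0\<close>: the relative error is at most \<open>h y / c\<close>.\<close>

lemma tendsto_ratio_one:
  fixes f g h :: "'a \<Rightarrow> real"
  assumes "c > 0" and "eventually (\<lambda>y. c \<le> g y) F"
    and "eventually (\<lambda>y. \<bar>f y - g y\<bar> \<le> h y) F" and "(h \<longlongrightarrow> 0) F"
  shows "((\<lambda>y. f y / g y) \<longlongrightarrow> 1) F"
proof -
  have "eventually (\<lambda>y. norm (f y / g y - 1) \<le> h y / c) F"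
    using assms(2,3)
  proof eventually_elim
    case (elim y)
    then have "norm (f y / g y - 1) = \<bar>f y - g y\<bar> / g y"
      using \<open>c > 0\<close> by (auto simp: diff_divide_distrib[symmetric] divide_simps abs_if)
    also have "\<dots> \<le> h y / c"
      using elim \<open>c > 0\<close> by (intro frac_le) auto
    finally show ?case .
  qed
  moreover have "((\<lambda>y. h y / c) \<longlongrightarrow> 0) F"
    using tendsto_divide_zero[OF assms(4)] .
  ultimately have "((\<lambda>y. f y / g y - 1) \<longlongrightarrow> 0) F"
    by (rule Lim_null_comparison)
  then show ?thesis
    by (rule LIM_zero_cancel)
qed

theorem proposition4p6:
  fixes d :: nat
    and lam :: "nat \<Rightarrow> real"
    and M :: "real \<Rightarrow> 'a measure"
    and X Y Z :: "real \<Rightarrow> nat \<Rightarrow> 'a \<Rightarrow> real"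
    and x :: nat
  assumes "d \<ge> 1"
    and "\<And>j. j \<in> {1..d} \<Longrightarrow> lam j > 0"
    and "\<And>\<theta>. \<theta> \<in> {0..1} \<Longrightarrow>
           comonotonic_shock_poisson (M \<theta>) d lam \<theta> (X \<theta>) (Y \<theta>) (Z \<theta>)"
  shows "((\<lambda>\<theta>. rv_cdf (M \<theta>) (vec_max d (X \<theta>)) (real x)
              / rv_cdf (M \<theta>) (vec_max d (Z \<theta>)) (real x)) \<longlongrightarrow> 1) (at 1 within {0..1})
       \<and> ((\<lambda>\<theta>. rv_cdf (M \<theta>) (vec_min d (X \<theta>)) (real x)
              / rv_cdf (M \<theta>) (vec_min d (Z \<theta>)) (real x)) \<longlongrightarrow> 1) (at 1 within {0..1})"
proof -
  let ?F = "at 1 within {0..1::real}"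
  let ?h = "\<lambda>\<theta>. \<Sum>j=1..d. 1 - exp (- ((1 - \<theta>) * lam j))"
  \<comment> \<open>The error bound is continuous in \<open>theta\<close>, and each summand is
    \<open>1 - exp 0\<close> at \<open>theta = 1\<close>.\<close>
  have "(?h \<longlongrightarrow> (\<Sum>j=1..d. 1 - exp (- ((1 - 1) * lam j)))) ?F"
    by (intro tendsto_intros)
  then have h: "(?h \<longlongrightarrow> 0) ?F"
    by simp
  \<comment> \<open>The model is given only for parameters in the unit interval; the one-sided
    filter supplies this eventually.\<close>
  have range: "eventually (\<lambda>\<theta>. \<theta> \<in> {0..1}) ?F"
    by (simp add: eventually_at_filter)
  have pos: "exp (- (\<Sum>j=1..d. lam j)) > 0"
    by simp
  show ?thesis
    using assms(3)
    by (intro conjI tendsto_ratio_one[OF pos _ _ h] eventually_mono[OF range]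
        comonotonic_shock_poisson.rv_cdf_vec_max_Z_ge comonotonic_shock_poisson.rv_cdf_vec_min_Z_ge
        comonotonic_shock_poisson.rv_cdf_vec_max_diff_le
        comonotonic_shock_poisson.rv_cdf_vec_min_diff_le) auto
qed

end
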